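(* Let $n\ge 2$ and let $p(z)=z^n+a_{n-1}z^{n-1}+\cdots+a_1z+a_0$ be a monic polynomial with $a_0,a_1,\dots,a_{n-1}\in\mathbb{C}$. If $\lambda$ is a root of $p(z)$, then $$|\lambda|\le 1+\frac12\left(|a_{n-1}|+\sqrt{|a_0+1|^2+|a_1|^2+|a_2|^2+\cdots+|a_{n-1}|^2}\right).$$ *)

theory Defs
  imports Complex_Main "HOL-Computational_Algebra.Polynomial"
begin

end

theory Submission
  imports Defs "HOL-Analysis.Convex"
begin

text \<open>
  Let \<open>z\<close> be a root of \<open>p\<close> and \<open>C\<close> the companion matrix, so that \<open>C\<close> sends the vector
  \<open>v = (z\<^sup>k)\<^sub>k\<close>, \<open>k < n\<close>, to \<open>z v\<close>. Changing the entry \<open>- a\<^sub>0\<close> of \<open>C\<close> to \<open>1\<close> and all other \<open>- a\<^sub>k\<close> to \<open>0\<close> leaves a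
  cyclic permutation matrix, whose numerical radius is at most \<open>1\<close>; the difference is
  supported in one row, whose entries up to sign are \<open>a\<^sub>0 + 1, a\<^sub>1, \<dots>, a\<^bsub>n-1\<^esub>\<close>. By Buzano's
  inequality the numerical radius of such a matrix is at most the mean of \<open>\<bar>a\<^bsub>n-1\<^esub>\<bar>\<close> and the
  Euclidean norm of that row.
  The bound on \<open>\<bar>z\<bar>\<close> is then the estimate of the Rayleigh quotient of \<open>C\<close> at \<open>v\<close>.

  Only absolute values enter these estimates, so the argument is carried out for the real vector
  \<open>(\<bar>z\<bar>\<^sup>k)\<^sub>k\<close>. The lemma \<open>sum_mult_cyclic_shift_le\<close> bounds the permutation part and
  \<open>Buzano_coordinate\<close> the rank-one part.
\<close>

text \<open>
  Each product is at most the mean of the two squares, and every square occurs in exactly two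
  products.
\<close>

lemma sum_mult_cyclic_shift_le:
  fixes x :: "nat \<Rightarrow> real"
  shows "(\<Sum>k<m. x (Suc k) * x k) + x 0 * x m \<le> (\<Sum>k\<le>m. (x k)\<^sup>2)"
proof -
  have "0 \<le> (\<Sum>k<m. (x (Suc k) - x k)\<^sup>2) + (x 0 - x m)\<^sup>2"
    by (intro add_nonneg_nonneg sum_nonneg) auto
  also have "\<dots> = (\<Sum>k<m. (x (Suc k))\<^sup>2) + (\<Sum>k<m. (x k)\<^sup>2) - 2 * (\<Sum>k<m. x (Suc k) * x k)
      + (x 0)\<^sup>2 + (x m)\<^sup>2 - 2 * (x 0 * x m)"
    by (simp add: power2_diff sum.distrib sum_subtractf sum_distrib_left mult.assoc)
  finally show ?thesis
    using sum.atMost_shift[of "\<lambda>k. (x k)\<^sup>2" m]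
    by (simp add: lessThan_Suc_atMost[symmetric] del: sum.lessThan_Suc_shift)
qed

text \<open>
  The one-sided form of Buzano's inequality
  \<open>2 \<langle>e, v\<rangle> \<langle>c, v\<rangle> \<le> (\<langle>e, c\<rangle> + \<parallel>e\<parallel> \<parallel>c\<parallel>) \<parallel>v\<parallel>\<^sup>2\<close> with
  \<open>e\<close> the \<open>j\<close>-th unit vector. It is a reflection argument: the vector \<open>w = 2 \<langle>e, v\<rangle> v - \<parallel>v\<parallel>\<^sup>2 e\<close> is \<open>\<parallel>v\<parallel>\<^sup>2\<close> times
  the mirror image of \<open>e\<close> in the line through \<open>v\<close>, so its norm is \<open>\<parallel>v\<parallel>\<^sup>2\<close>, and the Cauchy-Schwarz inequality for \<open>\<langle>c, w\<rangle>\<close> is the claim.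
\<close>

lemma Buzano_coordinate:
  fixes c v :: "'a \<Rightarrow> real"
  assumes fin: "finite I" and j: "j \<in> I"
  shows "v j * (\<Sum>i\<in>I. c i * v i) \<le> (c j + sqrt (\<Sum>i\<in>I. (c i)\<^sup>2)) / 2 * (\<Sum>i\<in>I. (v i)\<^sup>2)"
proof -
  define S where "S = (\<Sum>i\<in>I. (v i)\<^sup>2)"
  define w where "w i = 2 * v j * v i - (if i = j then S else 0)" for i
  have S: "S \<ge> 0"
    by (simp add: S_def sum_nonneg)
  have "(w i)\<^sup>2 = 4 * (v j)\<^sup>2 * (v i)\<^sup>2 + (if i = j then S\<^sup>2 - 4 * (v j)\<^sup>2 * S else 0)" for i
    by (simp add: w_def power2_eq_square algebra_simps)
  then have "(\<Sum>i\<in>I. (w i)\<^sup>2) = 4 * (v j)\<^sup>2 * S + (S\<^sup>2 - 4 * (v j)\<^sup>2 * S)"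
    using fin j by (simp add: sum.distrib sum_distrib_left[symmetric] S_def[symmetric])
  then have norm_w: "(\<Sum>i\<in>I. (w i)\<^sup>2) = S\<^sup>2"
    by simp
  have "c i * w i = 2 * v j * (c i * v i) - (if i = j then c j * S else 0)" for i
    by (simp add: w_def algebra_simps)
  then have cw: "(\<Sum>i\<in>I. c i * w i) = 2 * v j * (\<Sum>i\<in>I. c i * v i) - c j * S"
    using fin j by (simp add: sum_subtractf sum_distrib_left[symmetric])
  have "(\<Sum>i\<in>I. c i * w i)\<^sup>2 \<le> (\<Sum>i\<in>I. (c i)\<^sup>2) * S\<^sup>2"
    using Cauchy_Schwarz_ineq_sum[of c w I] by (simp add: norm_w)
  then have "(\<Sum>i\<in>I. c i * w i) \<le> sqrt ((\<Sum>i\<in>I. (c i)\<^sup>2) * S\<^sup>2)"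
    by (rule real_le_rsqrt)
  then have "2 * v j * (\<Sum>i\<in>I. c i * v i) - c j * S \<le> sqrt (\<Sum>i\<in>I. (c i)\<^sup>2) * S"
    using S by (simp add: cw real_sqrt_mult)
  then show ?thesis
    by (simp add: S_def[symmetric] field_simps)
qed

theorem theorem6p2:
  fixes n :: nat and p :: "complex poly" and z :: complex
  assumes "n \<ge> 2"
    and "degree p = n"
    and "lead_coeff p = 1"
    and "poly p z = 0"
  shows "cmod z \<le> 1 + 1 / 2 * (cmod (coeff p (n - 1))
           + sqrt ((cmod (coeff p 0 + 1))\<^sup>2 + (\<Sum>k = 1..n - 1. (cmod (coeff p k))\<^sup>2)))"
proof -
  define m where "m = n - 1"
  have n: "n = Suc m" and m: "m \<ge> 1"
    using assms(1) by (auto simp: m_def)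
  define b where "b k = coeff p k + (if k = 0 then 1 else 0)" for k
  define v where "v k = cmod z ^ k" for k
  define S where "S = (\<Sum>k\<le>m. (v k)\<^sup>2)"
  define B where "B = sqrt (\<Sum>k\<le>m. (cmod (b k))\<^sup>2)"
  have "S > 0"
    unfolding S_def by (rule sum_pos2[of _ 0]) (auto simp: v_def)

  \<comment> \<open>The last row of the companion matrix: the summand \<open>1\<close> belongs to the cyclic permutation,
      the sum to the rank-one part.\<close>
  have "(\<Sum>k\<le>m. coeff p k * z ^ k) + z ^ n = 0"
    using assms(2-4) by (simp add: poly_altdef n)
  moreover have "b k * z ^ k = coeff p k * z ^ k + (if k = 0 then 1 else 0)" for k
    by (simp add: b_def algebra_simps)
  ultimately have "z ^ n = 1 - (\<Sum>k\<le>m. b k * z ^ k)"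
    by (simp add: sum.distrib eq_neg_iff_add_eq_0 algebra_simps)
  then have "v n \<le> 1 + cmod (\<Sum>k\<le>m. b k * z ^ k)"
    using norm_triangle_ineq4[of 1 "\<Sum>k\<le>m. b k * z ^ k"]
    by (simp add: v_def norm_power[symmetric])
  also have "\<dots> \<le> 1 + (\<Sum>k\<le>m. cmod (b k) * v k)"
    using norm_sum[of "\<lambda>k. b k * z ^ k" "{..m}"] by (simp add: v_def norm_mult norm_power)
  finally have last_row: "v n \<le> v 0 + (\<Sum>k\<le>m. cmod (b k) * v k)"
    by (simp add: v_def)

  have "cmod z * S = (\<Sum>k\<le>m. v (Suc k) * v k)"
    by (simp add: S_def v_def sum_distrib_left power2_eq_square algebra_simps)
  also have "\<dots> = (\<Sum>k<m. v (Suc k) * v k) + v n * v m"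
    by (simp add: lessThan_Suc_atMost[symmetric] n)
  also have "\<dots> \<le> (\<Sum>k<m. v (Suc k) * v k) + (v 0 + (\<Sum>k\<le>m. cmod (b k) * v k)) * v m"
    using last_row by (intro add_left_mono mult_right_mono) (auto simp: v_def)
  also have "\<dots> = ((\<Sum>k<m. v (Suc k) * v k) + v 0 * v m) + v m * (\<Sum>k\<le>m. cmod (b k) * v k)"
    by (simp add: algebra_simps)
  also have "\<dots> \<le> S + (cmod (b m) + B) / 2 * S"
    unfolding S_def B_def
    by (intro add_mono sum_mult_cyclic_shift_le Buzano_coordinate) auto
  finally have "cmod z * S \<le> (1 + (cmod (b m) + B) / 2) * S"
    by (simp add: algebra_simps)
  then have "cmod z \<le> 1 + (cmod (b m) + B) / 2"
    using \<open>S > 0\<close> by simp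
  \<comment> \<open>Because \<open>n \<ge> 2\<close>, the index \<open>m\<close> is not \<open>0\<close>, so \<open>b m\<close> is the coefficient itself.\<close>
  moreover have "b m = coeff p (n - 1)"
    using m by (simp add: b_def m_def)
  moreover have "(\<Sum>k\<le>m. (cmod (b k))\<^sup>2)
      = (cmod (coeff p 0 + 1))\<^sup>2 + (\<Sum>k = 1..n - 1. (cmod (coeff p k))\<^sup>2)"
    by (simp add: atMost_atLeast0 sum.atLeast_Suc_atMost b_def m_def)
  ultimately show ?thesis
    by (simp add: B_def)
qed

end
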